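(* Let $\mathcal{D}$ be any normal and neutral domain, let $m$ be the number of alternatives in the input profile, and let $0<\delta<1/2$. Then for any $\varepsilon_v\ge\mathrm{res}_{\mathcal{D}}(m)$ there does not exist any $(\varepsilon_v,0,\delta,\mathcal{D})$-Arbitrary Outliers vs Random Profile Tester.
   Context: Profiles and domains. Let $\mathcal{A}$ be a finite set of $m$ alternatives and $\mathcal{L}(\mathcal{A})$ the set of linear orders (preferences) over $\mathcal{A}$; for $\mathcal{X}\subseteq\mathcal{A}$, $\succ(\mathcal{X})$ is the restriction of $\succ$ to $\mathcal{X}$. A profile is a tuple $(\succ_i)_{i\in[n]}$ of $n$ preferences over $\mathcal{A}$, one per agent. A domain $\mathcal{D}$ is a collection of subsets of $\bigcup_{|\mathcal{A}|>0}\mathcal{L}(\mathcal{A})$; a profile $\mathcal{P}$ of $n$ preferences belongs to $\mathcal{D}$ (written $\mathcal{P}\in\mathcal{D}$) if there is $\mathcal{B}\in\mathcal{D}$ with $\mathcal{P}\in\mathcal{B}^n$. $\mathcal{D}$ is neutral if membership of profiles in $\mathcal{D}$ is preserved under renaming the alternatives by any permutation (the same for all preferences of the profile). $\mathcal{D}$ is normal if $(\succ_i)_{i\in[n]}\in\mathcal{D}$ implies $(\succ_i(\mathcal{X}))_{i\in[n]}\in\mathcal{D}$ for every $\mathcal{X}\subseteq\mathcal{A}$. The content of $\mathcal{D}$ is the function $\mathrm{con}_{\mathcal{D}}:\mathbb{N}\to[0,1]$ such that $\mathrm{con}_{\mathcal{D}}(m)\,m!$ is the maximum number of distinct preferences in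 a profile over $m$ alternatives belonging to $\mathcal{D}$ (with $\mathrm{con}_{\mathcal{D}}(1)=1$); the residue is $\mathrm{res}_{\mathcal{D}}(m)=1-\mathrm{con}_{\mathcal{D}}(m)$. Sampling model. An oracle, when queried, returns an agent picked uniformly at random with replacement from the set of all $n$ agents. The algorithm may then ask this agent arbitrarily many comparison queries: given two alternatives $x,y$, the agent replies which of the two it prefers. Problem. An $(\varepsilon_v,0,\delta,\mathcal{D})$-Arbitrary Outliers vs Random Profile Tester is a (randomized) algorithm in this model which, given a profile $(\succ_i)_{i\in[n]}$ over $\mathcal{A}$ that is of one of the following two kinds, outputs $1$ if it is of kind (i) and $0$ if it is of kind (ii), with error probability at most $\delta$: (i) there exists $\mathcal{W}\subseteq[n]$ with $|\mathcal{W}|\ge(1-\varepsilon_v)n$ such that $(\succ_i)_{i\in\mathcal{W}}\in\mathcal{D}$; (ii) for every $i\in[n]$, $\succ_i$ is distributed (independently) uniformly in $\mathcal{L}(\mathcal{A})$. The error probability is over the randomness generating the instance in (ii) and the randomness of the algorithm (including the oracle). *)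

theory Defs
  imports "HOL-Probability.SPMF" "HOL-Probability.Product_PMF"
begin

section \<open>Preferences, profiles and domains\<close>

text \<open>
  Alternatives are elements of a fixed type; a preference over \<open>A\<close> is a (reflexive) linear order,
  with \<open>(x, y) \<in> r\<close> meaning that \<open>x\<close> is preferred to \<open>y\<close> (or \<open>x = y\<close>).
\<close>

definition preferences :: "'a set \<Rightarrow> 'a rel set" where
  "preferences A = {r. linear_order_on A r}"

text \<open>Agents are \<open>{1..n}\<close>; the values of \<open>P\<close> outside this set are irrelevant.\<close>

definition profile :: "'a set \<Rightarrow> nat \<Rightarrow> (nat \<Rightarrow> 'a rel) \<Rightarrow> bool" where
  "profile A n P \<longleftrightarrow> (\<forall>i\<in>{1..n}. P i \<in> preferences A)"

definition pref_domain :: "'a rel set set \<Rightarrow> bool" where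
  "pref_domain D \<longleftrightarrow> (\<forall>B\<in>D. B \<subseteq> (\<Union>A\<in>{A. finite A \<and> card A > 0}. preferences A))"

text \<open>The (sub)profile of \<open>P\<close> formed by the agents in \<open>I\<close> belongs to \<open>D\<close>.\<close>

definition belongs :: "'a rel set set \<Rightarrow> nat set \<Rightarrow> (nat \<Rightarrow> 'a rel) \<Rightarrow> bool" where
  "belongs D I P \<longleftrightarrow> (\<exists>B\<in>D. \<forall>i\<in>I. P i \<in> B)"

definition rename_pref :: "('a \<Rightarrow> 'a) \<Rightarrow> 'a rel \<Rightarrow> 'a rel" where
  "rename_pref \<pi> r = map_prod \<pi> \<pi> ` r"

text \<open>
  The renaming is a permutation of all alternatives, not only of the set \<open>A\<close> that underlies the
  profile: it can move \<open>A\<close> to any other set of the same size, so that membership does not depend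
  on the names of the alternatives.
\<close>

definition neutral_domain :: "'a rel set set \<Rightarrow> bool" where
  "neutral_domain D \<longleftrightarrow> (\<forall>A n P \<pi>. finite A \<longrightarrow> A \<noteq> {} \<longrightarrow> profile A n P \<longrightarrow> bij \<pi> \<longrightarrow>
     belongs D {1..n} P \<longrightarrow> belongs D {1..n} (\<lambda>i. rename_pref \<pi> (P i)))"

text \<open>
  Restrictions to the empty set are excluded since the preferences of a domain are over
  nonempty sets of alternatives.
\<close>

definition normal_domain :: "'a rel set set \<Rightarrow> bool" where
  "normal_domain D \<longleftrightarrow> (\<forall>A n P X. finite A \<longrightarrow> profile A n P \<longrightarrow> X \<subseteq> A \<longrightarrow> X \<noteq> {} \<longrightarrow>
     belongs D {1..n} P \<longrightarrow> belongs D {1..n} (\<lambda>i. Restr (P i) X))"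

text \<open>
  The supremum is a maximum, as all its elements are at most \<open>fact m\<close>; it is \<open>0\<close> if the set is
  empty.
\<close>

definition domain_content :: "'a rel set set \<Rightarrow> nat \<Rightarrow> real" where
  "domain_content D m =
     real (Sup {card (P ` {1..n}) | A n P.
       finite A \<and> card A = m \<and> profile A n P \<and> belongs D {1..n} P}) / fact m"

definition domain_residue :: "'a rel set set \<Rightarrow> nat \<Rightarrow> real" where
  "domain_residue D m = 1 - domain_content D m"


section \<open>Randomized algorithms in the sampling model\<close>

text \<open>
  An algorithm is a possibly infinite adaptive decision tree: it outputs a bit, makes an internal
  random choice, queries the oracle and continues according to the returned agent, or asks agent
  \<open>i\<close> to compare \<open>x\<close> and \<open>y\<close> and continues according to the preferred one of the two.
  No bound on the number of queries is imposed.
\<close>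

codatatype 'a algorithm =
    Output bool
  | Random "'a algorithm pmf"
  | Sample "nat \<Rightarrow> 'a algorithm"
  | Compare nat 'a 'a "'a \<Rightarrow> 'a algorithm"

text \<open>
  The output distribution of an algorithm on the profile \<open>P\<close> of \<open>n\<close> agents, where \<open>S\<close> is the set
  of agents returned by the oracle so far. Only these agents can be asked: an attempt to ask
  another one aborts the run. The missing mass of the subdistribution is the probability
  that the run aborts or does not terminate.
\<close>

partial_function (spmf) run ::
  "nat \<Rightarrow> (nat \<Rightarrow> 'a rel) \<Rightarrow> nat set \<Rightarrow> 'a algorithm \<Rightarrow> bool spmf" where
  "run n P S T = (case T of
      Output b \<Rightarrow> return_spmf b
    | Random p \<Rightarrow> bind_spmf (spmf_of_pmf p) (run n P S)
    | Sample k \<Rightarrow> bind_spmf (spmf_of_set {1..n}) (\<lambda>i. run n P (insert i S) (k i))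
    | Compare i x y k \<Rightarrow>
        (if i \<in> S then run n P S (k (if (x, y) \<in> P i then x else y)) else return_pmf None))"


section \<open>Arbitrary outliers vs random profile\<close>

definition outliers_instance ::
  "'a rel set set \<Rightarrow> real \<Rightarrow> 'a set \<Rightarrow> nat \<Rightarrow> (nat \<Rightarrow> 'a rel) \<Rightarrow> bool" where
  "outliers_instance D \<epsilon>\<^sub>v A n P \<longleftrightarrow> profile A n P \<and>
     (\<exists>W\<subseteq>{1..n}. real (card W) \<ge> (1 - \<epsilon>\<^sub>v) * real n \<and> belongs D W P)"

definition random_profile :: "'a set \<Rightarrow> nat \<Rightarrow> (nat \<Rightarrow> 'a rel) pmf" where
  "random_profile A n = Pi_pmf {1..n} undefined (\<lambda>_. pmf_of_set (preferences A))"

text \<open>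
  \<open>T\<close> is an \<open>(\<epsilon>\<^sub>v, 0, \<delta>, D)\<close>-Arbitrary Outliers vs Random Profile Tester for profiles of \<open>n\<close> agents
  over \<open>A\<close> (the parameter \<open>0\<close> plays no role). Any behaviour other than giving the required output
  is an error.
\<close>

definition outliers_vs_random_tester ::
  "real \<Rightarrow> real \<Rightarrow> 'a rel set set \<Rightarrow> 'a set \<Rightarrow> nat \<Rightarrow> 'a algorithm \<Rightarrow> bool" where
  "outliers_vs_random_tester \<epsilon>\<^sub>v \<delta> D A n T \<longleftrightarrow>
     (\<forall>P. outliers_instance D \<epsilon>\<^sub>v A n P \<longrightarrow> 1 - spmf (run n P {} T) True \<le> \<delta>) \<and>
     1 - spmf (bind_spmf (spmf_of_pmf (random_profile A n)) (\<lambda>P. run n P {} T)) False \<le> \<delta>"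

end

theory Submission
  imports Defs "HOL-Combinatorics.Permutations"
begin

text \<open>
  Every profile over \<open>A\<close> is an instance of the first kind, so a tester would have to give both
  answers on a random profile. Indeed, let \<open>S\<close> be a set of preferences that attains the content.
  For a uniformly random renaming \<open>\<pi>\<close> of the alternatives, a fixed preference lies in \<open>\<pi> S\<close> with
  probability \<open>card S / m!\<close>. So on average, and hence for some \<open>\<pi>\<close>, at least a
  \<open>con(m)\<close>-fraction of the agents have preferences in \<open>\<pi> S\<close>, which neutrality places in \<open>D\<close>.
\<close>

lemma finite_preferences:
  assumes "finite A"
  shows "finite (preferences A)"
proof (rule finite_subset)
  show "preferences A \<subseteq> Pow (A \<times> A)"
    by (auto simp: preferences_def order_on_defs)
qed (use assms in simp)

text \<open>Opens the theory of well-orders, from which \<open>preferences_permutation\<close> takes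
  the isomorphism between two preferences.\<close>

lemma well_order_on_preference:
  assumes "finite A" "r \<in> preferences A"
  shows "well_order_on A r"
proof -
  have lin: "linear_order_on A r" and "r \<subseteq> A \<times> A"
    using assms by (auto simp: preferences_def order_on_defs)
  then have "finite r"
    using assms(1) finite_subset by blast
  with lin show ?thesis
    using linear_order_on_well_order_on by blast
qed

text \<open>The well-ordering theorem supplies a member. With \<open>finite_preferences\<close>,
  this makes \<open>pmf_of_set (preferences A)\<close> the uniform distribution.\<close>

lemma preferences_nonempty: "preferences A \<noteq> {}"
  using well_order_on[of A] by (auto simp: preferences_def well_order_on_def)

lemma inj_rename_pref:
  assumes "inj \<pi>"
  shows "inj (rename_pref \<pi>)"
  unfolding rename_pref_def using inj_image_eq_iff[OF prod.inj_map[OF assms assms]] by (auto intro: injI)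

lemma in_rename_pref_iff:
  assumes "inj \<pi>"
  shows "(\<pi> x, \<pi> y) \<in> rename_pref \<pi> r \<longleftrightarrow> (x, y) \<in> r"
  using assms by (auto simp: rename_pref_def dest: injD)

lemma rename_pref_mem_preferences:
  assumes "inj \<pi>" "r \<in> preferences A"
  shows "rename_pref \<pi> r \<in> preferences (\<pi> ` A)"
proof -
  have r: "r \<subseteq> A \<times> A" "refl_on A r" "trans r" "antisym r" "total_on A r"
    using assms(2) by (auto simp: preferences_def order_on_defs)
  have "rename_pref \<pi> r \<subseteq> \<pi> ` A \<times> \<pi> ` A"
    using r(1) by (auto simp: rename_pref_def)
  moreover have "refl_on (\<pi> ` A) (rename_pref \<pi> r)"
    using r(2) by (auto simp: refl_on_def in_rename_pref_iff[OF assms(1)])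
  moreover have "total_on (\<pi> ` A) (rename_pref \<pi> r)"
    using r(5) by (auto simp: total_on_def in_rename_pref_iff[OF assms(1)])
  moreover have "trans (rename_pref \<pi> r)"
    using r(3) assms(1) unfolding rename_pref_def trans_def by (auto dest: injD)
  moreover have "antisym (rename_pref \<pi> r)"
    using r(4) assms(1) unfolding rename_pref_def antisym_def by (auto dest: injD)
  ultimately show ?thesis
    by (simp add: preferences_def order_on_defs)
qed

text \<open>Two well-orders of one finite set have the same order type, so an isomorphism between
  them is a bijection of \<open>A\<close> that renames \<open>r\<close> to \<open>s\<close>.\<close>

lemma preferences_permutation:
  assumes "finite A" "r \<in> preferences A" "s \<in> preferences A"
  obtains \<pi> where "\<pi> permutes A" "rename_pref \<pi> r = s"
proof -
  have wo: "well_order_on A r" "well_order_on A s"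
    using assms well_order_on_preference by blast+
  obtain f where "iso r s f"
    using finite_well_order_on_ordIso[OF assms(1) wo] by (auto simp: ordIso_def)
  then have f: "bij_betw f A A" "\<And>a b. a \<in> A \<Longrightarrow> b \<in> A \<Longrightarrow> (a, b) \<in> r \<longleftrightarrow> (f a, f b) \<in> s"
    using wo[THEN well_order_on_Field] by (auto simp: iso_iff2)
  \<comment> \<open>The isomorphism is arbitrary off \<open>A\<close>; \<open>permutes\<close>
    demands the identity there.\<close>
  define \<pi> where "\<pi> x = (if x \<in> A then f x else x)" for x
  have "bij_betw \<pi> A A"
    using f(1) by (simp add: \<pi>_def cong: bij_betw_cong)
  then have perm: "\<pi> permutes A"
    by (intro bij_imp_permutes) (auto simp: \<pi>_def)
  have sub: "r \<subseteq> A \<times> A" "s \<subseteq> A \<times> A"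
    using assms by (auto simp: preferences_def order_on_defs)
  have "rename_pref \<pi> r = s"
  proof (intro equalityI subrelI)
    fix x y assume "(x, y) \<in> rename_pref \<pi> r"
    then show "(x, y) \<in> s"
      using sub(1) f(2) by (auto simp: rename_pref_def \<pi>_def)
  next
    fix x y assume xy: "(x, y) \<in> s"
    then have "x \<in> f ` A" "y \<in> f ` A"
      using sub(2) f(1) by (auto simp: bij_betw_def)
    then obtain a b where ab: "a \<in> A" "b \<in> A" "x = f a" "y = f b"
      by blast
    then show "(x, y) \<in> rename_pref \<pi> r"
      using xy f(2) in_rename_pref_iff[OF permutes_inj[OF perm], of a b r] by (simp add: \<pi>_def)
  qed
  with perm show thesis by (rule that)
qed

text \<open>Neutrality renames by bijections of the whole type, so a bijection from \<open>A\<close>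
  to \<open>B\<close> has to be extended. Both differences have the same size, hence
  \<open>B - A\<close> can be sent back onto \<open>A - B\<close>, and everything else stays
  fixed.\<close>

lemma bij_extending_finite:
  assumes "finite A" "finite B" "card A = card B"
  obtains \<sigma> :: "'a \<Rightarrow> 'a" where "bij \<sigma>" "\<sigma> ` A = B"
proof -
  obtain f where f: "bij_betw f A B"
    using finite_same_card_bij assms by blast
  have "card (B - A) = card (A - B)"
    using assms by (simp add: card_Diff_subset_Int Int_commute)
  then obtain g where g: "bij_betw g (B - A) (A - B)"
    using finite_same_card_bij assms by (metis finite_Diff)
  define \<sigma> where "\<sigma> x = (if x \<in> A then f x else if x \<in> B then g x else x)" for x
  have A: "bij_betw \<sigma> A B"
    using f by (simp add: \<sigma>_def cong: bij_betw_cong)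
  have "bij_betw \<sigma> (B - A) (A - B)"
    using g by (subst bij_betw_cong[of _ _ g]) (auto simp: \<sigma>_def)
  from bij_betw_combine[OF A this] have "bij_betw \<sigma> (A \<union> B) (A \<union> B)"
    by (simp add: Un_commute)
  then have "\<sigma> permutes (A \<union> B)"
    by (intro bij_imp_permutes) (auto simp: \<sigma>_def)
  then have "bij \<sigma>" by (rule permutes_bij)
  moreover have "\<sigma> ` A = B" using A by (simp add: bij_betw_def)
  ultimately show thesis by (rule that)
qed

text \<open>Double counting of the pairs of an agent \<open>i\<close> and a permutation
  \<open>\<pi>\<close> with \<open>P i\<close> in the renamed \<open>S\<close>. Each agent lies in
  at least \<open>card S\<close> pairs, so some \<open>\<pi>\<close> reaches the average. The bound
  is multiplied out to stay in the naturals.\<close>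

lemma permutation_covering_agents:
  assumes "finite A" "S \<subseteq> preferences A" "profile A n P"
  obtains \<pi> where "\<pi> permutes A"
    "n * card S \<le> card {i\<in>{1..n}. P i \<in> rename_pref \<pi> ` S} * fact (card A)"
proof -
  define G where "G = {\<pi>. \<pi> permutes A}"
  define c where "c \<pi> = card {i\<in>{1..n}. P i \<in> rename_pref \<pi> ` S}" for \<pi>
  have fin: "finite G" and card: "card G = fact (card A)"
    using assms(1) by (auto simp: G_def finite_permutations card_permutations)
  have "id \<in> G" by (simp add: G_def permutes_id)
  then have nonempty: "G \<noteq> {}" by blast
  \<comment> \<open>Choose for each \<open>s\<close> in \<open>S\<close> a permutation
    \<open>g s\<close> taking it to \<open>P i\<close>. A single injective renaming cannot take two
    preferences to \<open>P i\<close>, so \<open>g\<close> is injective on \<open>S\<close>.\<close>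
  have "card S \<le> card {\<pi>\<in>G. P i \<in> rename_pref \<pi> ` S}" if "i \<in> {1..n}" for i
  proof -
    have "P i \<in> preferences A" using assms(3) that by (simp add: profile_def)
    then have "\<exists>\<pi>. \<pi> \<in> G \<and> rename_pref \<pi> s = P i" if "s \<in> S" for s
      using preferences_permutation[OF assms(1), of s "P i"] assms(2) that unfolding G_def by blast
    then obtain g where g: "\<And>s. s \<in> S \<Longrightarrow> g s \<in> G" "\<And>s. s \<in> S \<Longrightarrow> rename_pref (g s) s = P i"
      by metis
    have "inj_on g S"
    proof (rule inj_onI)
      fix s t assume "s \<in> S" "t \<in> S" "g s = g t"
      then have "rename_pref (g s) s = rename_pref (g s) t" "inj (g s)"
        using g(2)[of s] g(2)[of t] g(1)[of s] permutes_inj[of "g s" A] by (simp_all add: G_def)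
      then show "s = t" using injD[OF inj_rename_pref] by blast
    qed
    moreover have "g ` S \<subseteq> {\<pi>\<in>G. P i \<in> rename_pref \<pi> ` S}"
    proof clarify
      fix s assume "s \<in> S"
      then show "g s \<in> G \<and> P i \<in> rename_pref (g s) ` S"
        using g(1)[of s] g(2)[of s, symmetric] by blast
    qed
    ultimately show ?thesis
      using fin by (intro card_inj_on_le[of g]) auto
  qed
  then have "(\<Sum>i\<in>{1..n}. card S) \<le> (\<Sum>i\<in>{1..n}. card {\<pi>\<in>G. P i \<in> rename_pref \<pi> ` S})"
    by (intro sum_mono)
  \<comment> \<open>The same pairs, now grouped by permutation.\<close>
  also have "\<dots> = (\<Sum>\<pi>\<in>G. c \<pi>)"
    unfolding c_def using fin by (intro sum_multicount_gen) auto
  finally have le: "n * card S \<le> (\<Sum>\<pi>\<in>G. c \<pi>)" by simp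
  obtain \<pi> where \<pi>: "\<pi> \<in> G" "\<And>\<rho>. \<rho> \<in> G \<Longrightarrow> c \<rho> \<le> c \<pi>"
  proof -
    have "Max (c ` G) \<in> c ` G" using fin nonempty by simp
    then obtain \<pi> where "\<pi> \<in> G" "Max (c ` G) = c \<pi>" by (rule imageE) simp
    moreover have "\<And>\<rho>. \<rho> \<in> G \<Longrightarrow> c \<rho> \<le> Max (c ` G)"
      using fin by simp
    ultimately show thesis by (intro that[of \<pi>]) metis+
  qed
  have "(\<Sum>\<rho>\<in>G. c \<rho>) \<le> c \<pi> * fact (card A)"
    using sum_bounded_above[of G c "c \<pi>"] \<pi>(2) card by (simp add: mult.commute)
  with le \<pi>(1) show thesis
    by (intro that[of \<pi>]) (auto simp: G_def c_def)
qed

text \<open>The content ranges over profiles on all sets of size \<open>card A\<close>. Neutrality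
  moves each of them onto \<open>A\<close>, and injectivity of the renaming keeps the number of
  distinct preferences. The supremum is then a maximum of a finite nonempty set.\<close>

lemma domain_content_attained:
  assumes "finite A" "A \<noteq> {}" "neutral_domain D" "D \<noteq> {}"
  obtains N Q where "profile A N Q" "belongs D {1..N} Q"
    "domain_content D (card A) = real (card (Q ` {1..N})) / fact (card A)"
proof -
  define X where "X = {card (P ` {1..n}) | B n P.
    finite B \<and> card B = card A \<and> profile B n P \<and> belongs D {1..n} P}"
  have transfer: "\<exists>N Q. profile A N Q \<and> belongs D {1..N} Q \<and> k = card (Q ` {1..N})"
    if k: "k \<in> X" for k
  proof -
    obtain B N P where P: "finite B" "card B = card A" "profile B N P" "belongs D {1..N} P"
      "k = card (P ` {1..N})"
      using k unfolding X_def by blast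
    obtain \<sigma> where \<sigma>: "bij \<sigma>" "\<sigma> ` B = A"
      by (rule bij_extending_finite[OF P(1) assms(1) P(2)])
    define Q where "Q i = rename_pref \<sigma> (P i)" for i
    have "B \<noteq> {}" using P(2) assms(1,2) by auto
    then have "belongs D {1..N} Q"
      unfolding Q_def
      using assms(3)[unfolded neutral_domain_def, rule_format, OF P(1) _ P(3) \<sigma>(1) P(4)] by blast
    moreover have "profile A N Q"
      using P(3) \<sigma> rename_pref_mem_preferences[of \<sigma>] by (auto simp: profile_def Q_def bij_is_inj)
    moreover have "card (Q ` {1..N}) = card (P ` {1..N})"
      unfolding Q_def image_image[symmetric, of "rename_pref \<sigma>" P]
      using inj_rename_pref[OF bij_is_inj[OF \<sigma>(1)]] by (intro card_image) (auto intro: inj_on_subset)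
    ultimately show ?thesis using P(5) by metis
  qed
  have "X \<subseteq> {..card (preferences A)}"
  proof
    fix k assume "k \<in> X"
    then obtain N Q where "profile A N Q" "k = card (Q ` {1..N})" using transfer by blast
    then show "k \<in> {..card (preferences A)}"
      using card_mono[OF finite_preferences[OF assms(1)], of "Q ` {1..N}"]
      by (auto simp: profile_def image_subset_iff)
  qed
  then have "finite X" using finite_subset by blast
  \<comment> \<open>The profile without agents belongs to \<open>D\<close> vacuously once
    \<open>D\<close> has a member. It covers the case where \<open>D\<close> has no preferences on
    sets of this size and the content is 0.\<close>
  moreover have "X \<noteq> {}"
  proof -
    obtain B where "B \<in> D" using assms(4) by blast
    then have "profile A 0 (\<lambda>_. {})" "belongs D {1..0} (\<lambda>_. {})"
      by (auto simp: profile_def belongs_def)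
    then have "card ((\<lambda>_. {} :: 'a rel) ` {1..0::nat}) \<in> X"
      unfolding X_def using assms(1) by (intro CollectI exI conjI) auto
    then show ?thesis by blast
  qed
  ultimately have "Sup X \<in> X"
    by (simp add: Max_in Sup_nat_def)
  then obtain N Q where "profile A N Q" "belongs D {1..N} Q" "Sup X = card (Q ` {1..N})"
    using transfer by blast
  then show thesis
    by (intro that[of N Q]) (simp_all add: domain_content_def X_def)
qed

lemma every_profile_outliers_instance:
  assumes "finite A" "A \<noteq> {}" "neutral_domain D" "D \<noteq> {}"
    and "\<epsilon> \<ge> domain_residue D (card A)" "profile A n P"
  shows "outliers_instance D \<epsilon> A n P"
proof -
  obtain N Q where Q: "profile A N Q" "belongs D {1..N} Q"
    "domain_content D (card A) = real (card (Q ` {1..N})) / fact (card A)"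
    by (rule domain_content_attained[OF assms(1-4)])
  define S where "S = Q ` {1..N}"
  have "S \<subseteq> preferences A" using Q(1) by (auto simp: S_def profile_def)
  from assms(1) this assms(6) obtain \<pi> where \<pi>: "\<pi> permutes A"
    and le: "n * card S \<le> card {i\<in>{1..n}. P i \<in> rename_pref \<pi> ` S} * fact (card A)"
    by (rule permutation_covering_agents)
  define W where "W = {i\<in>{1..n}. P i \<in> rename_pref \<pi> ` S}"
  \<comment> \<open>Neutrality is applied to the whole attaining profile, so one \<open>B\<close> in
    \<open>D\<close> contains all of the renamed \<open>S\<close>, and with it the preferences of
    all agents in \<open>W\<close>.\<close>
  have "belongs D {1..N} (\<lambda>i. rename_pref \<pi> (Q i))"
    using assms(3)[unfolded neutral_domain_def, rule_format,
        OF assms(1,2) Q(1) permutes_bij[OF \<pi>] Q(2)] .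
  then obtain B where "B \<in> D" and B: "\<And>i. i \<in> {1..N} \<Longrightarrow> rename_pref \<pi> (Q i) \<in> B"
    unfolding belongs_def by blast
  have "\<forall>i\<in>W. P i \<in> B"
    using B unfolding W_def S_def by force
  with \<open>B \<in> D\<close> have "belongs D W P"
    unfolding belongs_def by blast
  moreover have "real (card W) \<ge> (1 - \<epsilon>) * real n"
  proof -
    have "(1 - \<epsilon>) * real n \<le> domain_content D (card A) * real n"
      using assms(5) by (intro mult_right_mono) (auto simp: domain_residue_def)
    also have "\<dots> = real (n * card S) / fact (card A)"
      by (simp add: Q(3) S_def)
    also have "\<dots> \<le> real (card W)"
    proof -
      have "real (n * card S) \<le> real (card W * fact (card A))"
        using le unfolding W_def by (simp only: of_nat_le_iff)
      then show ?thesis by (simp add: pos_divide_le_eq)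
    qed
    finally show ?thesis .
  qed
  moreover have "W \<subseteq> {1..n}" by (auto simp: W_def)
  ultimately show ?thesis
    using assms(6) unfolding outliers_instance_def by blast
qed

lemma set_pmf_random_profile:
  assumes "finite A" "P \<in> set_pmf (random_profile A n)"
  shows "profile A n P"
  using assms finite_preferences[OF assms(1)] preferences_nonempty[of A]
  by (auto simp: random_profile_def set_Pi_pmf PiE_dflt_def profile_def)

text \<open>Turns a high probability of \<open>True\<close> into a low one of \<open>False\<close>.
  Only an inequality holds, since a run may abort or diverge.\<close>

lemma spmf_True_False_le_one: "spmf p True + spmf p False \<le> 1"
proof -
  have "measure (measure_spmf p) {True, False} = spmf p True + spmf p False"
    by (subst measure_spmf.finite_measure_eq_sum_singleton) (auto simp: spmf_conv_measure_spmf)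
  then show ?thesis
    using measure_spmf.subprob_measure_le_1[of p "{True, False}"] by simp
qed

theorem proposition3p3:
  fixes D :: "'a rel set set" and A :: "'a set" and m n :: nat and \<epsilon>\<^sub>v \<delta> :: real
  assumes "pref_domain D" and "domain_content D 1 = 1"
    and "normal_domain D" and "neutral_domain D"
    and "finite A" and "card A = m" and "m \<ge> 1"
    and "n \<ge> 1"
    and "0 < \<delta>" and "\<delta> < 1 / 2"
    and "\<epsilon>\<^sub>v \<ge> domain_residue D m"
  shows "\<not> (\<exists>T :: 'a algorithm. outliers_vs_random_tester \<epsilon>\<^sub>v \<delta> D A n T)"
proof
  assume "\<exists>T :: 'a algorithm. outliers_vs_random_tester \<epsilon>\<^sub>v \<delta> D A n T"
  then obtain T :: "'a algorithm" where
    T1: "\<And>P. outliers_instance D \<epsilon>\<^sub>v A n P \<Longrightarrow> 1 - spmf (run n P {} T) True \<le> \<delta>" and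
    T2: "1 - spmf (bind_spmf (spmf_of_pmf (random_profile A n)) (\<lambda>P. run n P {} T)) False \<le> \<delta>"
    unfolding outliers_vs_random_tester_def by blast
  have "A \<noteq> {}" using assms by auto
  have "D \<noteq> {}"
  proof
    assume "D = {}"
    \<comment> \<open>Over an empty \<open>D\<close> the supremum is that of the empty set of
      naturals, which is 0.\<close>
    then have "domain_content D 1 = 0"
      by (simp add: domain_content_def belongs_def)
    with assms(2) show False by simp
  qed
  have "spmf (run n P {} T) False \<le> \<delta>" if "P \<in> set_pmf (random_profile A n)" for P
  proof -
    have "outliers_instance D \<epsilon>\<^sub>v A n P"
      using assms \<open>A \<noteq> {}\<close> \<open>D \<noteq> {}\<close> that
      by (intro every_profile_outliers_instance set_pmf_random_profile) auto
    then show ?thesis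
      using T1[of P] spmf_True_False_le_one[of "run n P {} T"] by linarith
  qed
  \<comment> \<open>The bound holds for each profile in the support, so it survives averaging. The
    correctness demand on random profiles then forces \<open>1 - \<delta> \<le> \<delta>\<close>,
    contradicting \<open>\<delta> < 1 / 2\<close>.\<close>
  then have "measure_pmf.expectation (random_profile A n) (\<lambda>P. spmf (run n P {} T) False) \<le> \<delta>"
    by (intro measure_pmf.integral_le_const measure_pmf.integrable_const_bound[where B = 1])
       (auto simp: AE_measure_pmf_iff pmf_le_1)
  then have "spmf (bind_spmf (spmf_of_pmf (random_profile A n)) (\<lambda>P. run n P {} T)) False \<le> \<delta>"
    by (subst spmf_bind) simp
  with T2 assms(10) show False by linarith
qed

end
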